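(* Let $C$ be a nonempty closed convex subset of a real Hilbert space $H$ and let $T:C\to C$ be an $L$-Lipschitz mapping. Assume that $F(T)\neq\emptyset$ is closed and convex, that $I-T$ is demiclosed at zero, that $\{\mu_n\}_{n\ge 0}$ is a real sequence with $L+1\le\mu_n\le\mu<\infty$ for all $n$ (for some constant $\mu$), and that for each $n\ge 0$, $\theta_n:C\to[0,\infty)$ is a nonnegative function on $C$. Let $x_0\in C$ be arbitrary and let $\{x_n\}$ be generated, for $n\ge 0$, by $$C_n=\{z\in C:\|x_n-Tx_n\|\le\mu_n\|x_n-z\|+\theta_n(z)\},$$ $$Q_n=\{z\in C:\langle z-x_n,x_n-x_0\rangle\ge 0\},$$ $$x_{n+1}=P_{C_n^*\cap Q_n}x_0,$$ where $C_n^*$ is a closed convex set with $F(T)\subset C_n^*\subset C_n$. Assume $\lim_{n\to\infty}\theta_n(x_{n+1})=0$. Then $\{x_n\}$ converges strongly to $P_{F(T)}x_0$.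
   Context: $F(T)=\{x\in C:Tx=x\}$ is the set of fixed points of $T$. $T$ is $L$-Lipschitz if $\|Tx-Ty\|\le L\|x-y\|$ for all $x,y\in C$. $I$ is the identity. $I-T$ is demiclosed at zero if, whenever a sequence $\{u_n\}\subset C$ converges weakly to $u$ and $(I-T)u_n\to 0$ strongly, then $(I-T)u=0$. For a nonempty closed convex set $D\subset H$, $P_D$ is the metric projection: $P_Dx$ is the unique nearest point of $D$ to $x$. Strong convergence is norm convergence. *)

theory Defs
  imports "HOL-Analysis.Analysis"
begin

text \<open>
  A real Hilbert space is a type of sort \<open>{real_inner, complete_space}\<close>. Maps that are only
  given on a subset \<open>C\<close> are total functions, and their values outside \<open>C\<close> are never used.
\<close>

definition fixed_points :: "'a set \<Rightarrow> ('a \<Rightarrow> 'a) \<Rightarrow> 'a set" where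
  "fixed_points C T = {x \<in> C. T x = x}"

definition weakly_converges :: "(nat \<Rightarrow> 'a::real_normed_vector) \<Rightarrow> 'a \<Rightarrow> bool" where
  "weakly_converges u l \<longleftrightarrow>
     (\<forall>f :: 'a \<Rightarrow> real. bounded_linear f \<longrightarrow> (\<lambda>n. f (u n)) \<longlonglongrightarrow> f l)"

text \<open>
  The weak limit is required to lie in \<open>C\<close> only so that \<open>S l\<close> is meaningful. For closed
  convex \<open>C\<close> this is automatic, because such a set is weakly sequentially closed.
\<close>

definition demiclosed_at_zero ::
  "'a::real_normed_vector set \<Rightarrow> ('a \<Rightarrow> 'a) \<Rightarrow> bool" where
  "demiclosed_at_zero C S \<longleftrightarrow>
     (\<forall>u l. (\<forall>n. u n \<in> C) \<longrightarrow> l \<in> C \<longrightarrow> weakly_converges u l \<longrightarrow>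
        (\<lambda>n. S (u n)) \<longlonglongrightarrow> 0 \<longrightarrow> S l = 0)"

text \<open>
  The library's \<open>closest_point\<close> is confined to Heine-Borel (hence finite-dimensional) spaces.
  The description below denotes the nearest point whenever \<open>D\<close> is nonempty, closed and convex
  in a Hilbert space.
\<close>

definition metric_proj :: "'a::real_normed_vector set \<Rightarrow> 'a \<Rightarrow> 'a" where
  "metric_proj D x = (THE p. p \<in> D \<and> (\<forall>z\<in>D. norm (x - p) \<le> norm (x - z)))"

end

theory Submission
  imports Defs "HOL-Complex_Analysis.Great_Picard"
begin

text \<open>
  Each \<open>x n\<close> is the nearest point of the half-space slice \<open>Q n\<close> to \<open>x 0\<close>, and \<open>x (Suc n)\<close>
  lies in that slice. The obtuse-angle inequality for projections therefore makes
  \<open>norm (x n - x 0)\<close> nondecreasing, with squared increments that dominate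
  \<open>(norm (x n - x (Suc n)))\<^sup>2\<close>. The fixed points belong to every \<open>Q n\<close>, again by the
  obtuse-angle inequality, so these distances are bounded and consecutive iterates approach each
  other (\<open>successive_differences_tendsto_zero\<close>). Since \<open>x (Suc n)\<close> lies in \<open>Cn n\<close>, the residual
  \<open>norm (x n - T (x n))\<close> is at most \<open>M * norm (x n - x (Suc n)) + \<theta> n (x (Suc n))\<close>, which tends
  to zero. Demiclosedness then puts every weak cluster point of the iterates into the fixed point set.

  The sets \<open>Q n\<close> need not be nested, so this argument does not show the sequence to be Cauchy. Strong
  convergence comes instead from \<open>weak_cluster_points_imp_strong_limit\<close>: membership of the fixed
  points in \<open>Q n\<close> bounds \<open>(norm (x n - p))\<^sup>2\<close>, for \<open>p\<close> the projection of \<open>x 0\<close>, by an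
  expression that is affine in \<open>x n\<close>. Such an expression passes to weak limits, and at a weak limit
  inside the fixed point set it is nonpositive.

  The functional analysis behind this is developed first: existence of metric projections, the
  Riesz representation of bounded functionals, weak sequential compactness of bounded sequences, and
  weak closedness of closed convex sets. The last three rest on the first.
\<close>

section \<open>Metric projection in a Hilbert space\<close>

text \<open>
  The parallelogram law, applied at the midpoint of \<open>a\<close> and \<open>b\<close>, which lies in \<open>D\<close> by
  convexity. It makes minimising sequences Cauchy.
\<close>

lemma near_minimizers_close:
  fixes D :: "'a::real_inner set"
  assumes "convex D" and ab: "a \<in> D" "b \<in> D"
    and m: "\<And>z. z \<in> D \<Longrightarrow> m \<le> (norm (x - z))\<^sup>2"
  shows "(norm (a - b))\<^sup>2 \<le> 2 * ((norm (x - a))\<^sup>2 - m) + 2 * ((norm (x - b))\<^sup>2 - m)"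
proof -
  define c where "c = (1/2) *\<^sub>R a + (1/2) *\<^sub>R b"
  have "c \<in> D"
    unfolding c_def using convexD[OF \<open>convex D\<close> ab, of "1/2" "1/2"] by simp
  then have "m \<le> (norm (x - c))\<^sup>2" by (rule m)
  moreover have "(norm (a - b))\<^sup>2 = 2 * (norm (x - a))\<^sup>2 + 2 * (norm (x - b))\<^sup>2 - 4 * (norm (x - c))\<^sup>2"
    unfolding c_def power2_norm_eq_inner
    by (simp add: inner_simps inner_commute algebra_simps)
  ultimately show ?thesis by simp
qed

lemma nearest_point_ex1:
  fixes D :: "'a::{real_inner, complete_space} set"
  assumes D: "D \<noteq> {}" "closed D" "convex D"
  shows "\<exists>!p. p \<in> D \<and> (\<forall>z\<in>D. norm (x - p) \<le> norm (x - z))"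
proof (rule ex_ex1I)
  define m where "m = (INF z\<in>D. (norm (x - z))\<^sup>2)"
  have bdd: "bdd_below ((\<lambda>z. (norm (x - z))\<^sup>2) ` D)"
    by (rule bdd_belowI[of _ 0]) auto
  have m: "m \<le> (norm (x - z))\<^sup>2" if "z \<in> D" for z
    unfolding m_def by (rule cINF_lower[OF bdd that])
  have "\<exists>z\<in>D. (norm (x - z))\<^sup>2 < m + inverse (real (Suc n))" for n
    using cINF_less_iff[OF D(1) bdd, of "m + inverse (real (Suc n))"] by (simp add: m_def)
  then obtain s where s: "\<And>n. s n \<in> D"
      "\<And>n. (norm (x - s n))\<^sup>2 < m + inverse (real (Suc n))"
    by metis
  have "Cauchy s"
  proof (rule metric_CauchyI)
    fix e :: real assume "e > 0"
    then obtain N where N: "inverse (real (Suc N)) < e\<^sup>2 / 4"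
      using reals_Archimedean[of "e\<^sup>2 / 4"] by auto
    have tail: "(norm (x - s n))\<^sup>2 < m + e\<^sup>2 / 4" if "n \<ge> N" for n
    proof -
      have "inverse (real (Suc n)) \<le> inverse (real (Suc N))" using that by simp
      then show ?thesis using s(2)[of n] N by linarith
    qed
    have "dist (s i) (s j) < e" if "i \<ge> N" "j \<ge> N" for i j
    proof -
      have "(norm (s i - s j))\<^sup>2 < e\<^sup>2"
        using near_minimizers_close[OF D(3) s(1) s(1) m, of i j] tail[OF that(1)] tail[OF that(2)]
        by (simp add: field_simps)
      then show ?thesis
        using \<open>e > 0\<close> by (simp add: dist_norm power2_less_imp_less)
    qed
    then show "\<exists>N. \<forall>i\<ge>N. \<forall>j\<ge>N. dist (s i) (s j) < e" by blast
  qed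
  then obtain p where p: "s \<longlonglongrightarrow> p"
    using Cauchy_convergent_iff convergent_def by blast
  have "p \<in> D" using closed_sequentially[OF D(2) _ p] s(1) by blast
  have "(norm (x - p))\<^sup>2 \<le> m"
  proof (rule LIMSEQ_le)
    show "(\<lambda>n. (norm (x - s n))\<^sup>2) \<longlonglongrightarrow> (norm (x - p))\<^sup>2"
      by (intro tendsto_intros p)
    show "(\<lambda>n. m + inverse (real (Suc n))) \<longlonglongrightarrow> m"
      using tendsto_add[OF tendsto_const LIMSEQ_inverse_real_of_nat, of m] by simp
    show "\<exists>N. \<forall>n\<ge>N. (norm (x - s n))\<^sup>2 \<le> m + inverse (real (Suc n))"
      using s(2) less_imp_le by blast
  qed
  then have "norm (x - p) \<le> norm (x - z)" if "z \<in> D" for z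
    using order_trans[OF _ m[OF that]] by (intro power2_le_imp_le[OF _ norm_ge_zero]) blast
  with \<open>p \<in> D\<close> show "\<exists>p. p \<in> D \<and> (\<forall>z\<in>D. norm (x - p) \<le> norm (x - z))" by blast
next
  fix p q
  assume p: "p \<in> D \<and> (\<forall>z\<in>D. norm (x - p) \<le> norm (x - z))"
    and q: "q \<in> D \<and> (\<forall>z\<in>D. norm (x - q) \<le> norm (x - z))"
  then show "p = q"
    using any_closest_point_unique[OF D(3,2), of p q x] by (simp add: dist_norm)
qed

lemma
  fixes D :: "'a::{real_inner, complete_space} set"
  assumes D: "D \<noteq> {}" "closed D" "convex D"
  shows metric_proj_in: "metric_proj D x \<in> D"
    and metric_proj_dot: "z \<in> D \<Longrightarrow> inner (x - metric_proj D x) (z - metric_proj D x) \<le> 0"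
proof -
  have P: "metric_proj D x \<in> D \<and> (\<forall>z\<in>D. norm (x - metric_proj D x) \<le> norm (x - z))"
    unfolding metric_proj_def by (rule theI'[OF nearest_point_ex1[OF D]])
  then show "metric_proj D x \<in> D" by simp
  show "inner (x - metric_proj D x) (z - metric_proj D x) \<le> 0" if "z \<in> D"
    using any_closest_point_dot[OF D(3,2), of "metric_proj D x" z x] P that
    by (simp add: dist_norm)
qed

text \<open>
  On a subspace the variational inequality applies to both \<open>P y + v\<close> and \<open>P y - v\<close>, so it becomes
  an equality.
\<close>

lemma metric_proj_subspace_orthogonal:
  fixes V :: "'a::{real_inner, complete_space} set"
  assumes V: "subspace V" "closed V" and "v \<in> V"
  shows "inner (y - metric_proj V y) v = 0"
proof -
  have V': "V \<noteq> {}" "closed V" "convex V"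
    using V subspace_0 subspace_imp_convex by auto
  let ?p = "metric_proj V y"
  have "?p \<in> V" by (rule metric_proj_in[OF V'])
  then have "?p + v \<in> V" "?p - v \<in> V"
    using V(1) \<open>v \<in> V\<close> by (auto intro: subspace_add subspace_diff)
  from this[THEN metric_proj_dot[OF V', of _ y]] show ?thesis by simp
qed

section \<open>Weak convergence in a Hilbert space\<close>

text \<open>
  Away from the trivial case, the kernel \<open>V\<close> of \<open>f\<close> has codimension one, and the
  representing vector is a multiple of the component \<open>v\<close> orthogonal to \<open>V\<close> of any \<open>y0\<close>
  outside \<open>V\<close>.
\<close>

lemma riesz_representation:
  fixes f :: "'a::{real_inner, complete_space} \<Rightarrow> real"
  assumes f: "bounded_linear f"
  shows "\<exists>w. \<forall>y. f y = inner y w"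
proof (cases "\<forall>y. f y = 0")
  case True
  then show ?thesis by (intro exI[of _ 0]) simp
next
  case False
  interpret f: bounded_linear f by (rule f)
  from False obtain y0 where "f y0 \<noteq> 0" by blast
  define V where "V = {y. f y = 0}"
  have V: "subspace V" "closed V"
  proof -
    show "subspace V" by (auto simp: V_def subspace_def f.add f.scaleR)
    show "closed V" unfolding V_def
      by (intro closed_Collect_eq continuous_on_const
          linear_continuous_on[OF f])
  qed
  define v where "v = y0 - metric_proj V y0"
  have "metric_proj V y0 \<in> V"
    using V subspace_0 subspace_imp_convex by (intro metric_proj_in) auto
  then have fv: "f v = f y0" by (simp add: v_def V_def f.diff)
  then have "v \<noteq> 0" using \<open>f y0 \<noteq> 0\<close> f.zero by auto
  have "f y = inner y ((f v / inner v v) *\<^sub>R v)" for y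
  proof -
    have "y - (f y / f v) *\<^sub>R v \<in> V"
      using fv \<open>f y0 \<noteq> 0\<close> by (simp add: V_def f.diff f.scaleR)
    from metric_proj_subspace_orthogonal[OF V this, of y0]
    have "inner v y = (f y / f v) * inner v v" by (simp add: v_def[symmetric] inner_diff_right)
    then show ?thesis using fv \<open>f y0 \<noteq> 0\<close> \<open>v \<noteq> 0\<close> by (simp add: inner_commute)
  qed
  then show ?thesis by blast
qed

lemma weakly_converges_iff_inner:
  fixes u :: "nat \<Rightarrow> 'a::{real_inner, complete_space}"
  shows "weakly_converges u l \<longleftrightarrow> (\<forall>y. (\<lambda>n. inner (u n) y) \<longlonglongrightarrow> inner l y)"
proof
  assume "weakly_converges u l"
  then show "\<forall>y. (\<lambda>n. inner (u n) y) \<longlonglongrightarrow> inner l y"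
    unfolding weakly_converges_def using bounded_linear_inner_left by blast
next
  assume R: "\<forall>y. (\<lambda>n. inner (u n) y) \<longlonglongrightarrow> inner l y"
  show "weakly_converges u l"
    unfolding weakly_converges_def
  proof (intro allI impI)
    fix f :: "'a \<Rightarrow> real" assume "bounded_linear f"
    then obtain w where "\<And>y. f y = inner y w" using riesz_representation by blast
    then show "(\<lambda>n. f (u n)) \<longlonglongrightarrow> f l" using R by simp
  qed
qed

text \<open>
  The functionals \<open>inner (u n)\<close> are equicontinuous by the bound \<open>B\<close>, so the Cauchy property
  survives a small change of the argument.
\<close>

lemma closed_Collect_convergent_inner:
  fixes u :: "nat \<Rightarrow> 'a::real_inner"
  assumes B: "\<And>n. norm (u n) \<le> B"
  shows "closed {y. convergent (\<lambda>n. inner (u n) y)}" (is "closed ?V")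
proof -
  have "y \<in> ?V" if y: "y \<in> closure ?V" for y
  proof -
    have "0 \<le> B" using B[of 0] norm_ge_zero order_trans by blast
    have "Cauchy (\<lambda>n. inner (u n) y)"
    proof (rule metric_CauchyI)
      fix e :: real assume "e > 0"
      define d where "d = e / (4 * (B + 1))"
      have "d > 0" using \<open>e > 0\<close> \<open>0 \<le> B\<close> by (simp add: d_def)
      then obtain v where v: "v \<in> ?V" "dist v y < d"
        using y unfolding closure_approachable by blast
      have near: "\<bar>inner (u n) y - inner (u n) v\<bar> \<le> e / 4" for n
      proof -
        have "\<bar>inner (u n) y - inner (u n) v\<bar> \<le> norm (u n) * norm (y - v)"
          using Cauchy_Schwarz_ineq2[of "u n" "y - v"] by (simp add: inner_diff_right)
        also have "\<dots> \<le> (B + 1) * d"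
          using B[of n] v(2) \<open>0 \<le> B\<close>
          by (intro mult_mono) (auto simp: dist_norm norm_minus_commute)
        also have "\<dots> = e / 4" using \<open>0 \<le> B\<close> by (simp add: d_def field_simps)
        finally show ?thesis .
      qed
      have "Cauchy (\<lambda>n. inner (u n) v)" using v(1) by (simp add: convergent_Cauchy)
      then obtain N where N: "\<And>i j. i \<ge> N \<Longrightarrow> j \<ge> N \<Longrightarrow> dist (inner (u i) v) (inner (u j) v) < e / 4"
        using \<open>e > 0\<close> unfolding Cauchy_def by (metis zero_less_divide_iff zero_less_numeral)
      have "dist (inner (u i) y) (inner (u j) y) < e" if "i \<ge> N" "j \<ge> N" for i j
        using near[of i] near[of j] N[OF that] \<open>e > 0\<close> unfolding dist_real_def by linarith
      then show "\<exists>N. \<forall>i\<ge>N. \<forall>j\<ge>N. dist (inner (u i) y) (inner (u j) y) < e" by blast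
    qed
    then show ?thesis by (simp add: Cauchy_convergent_iff)
  qed
  then show ?thesis by (metis closure_subset_eq subsetI)
qed

text \<open>
  A diagonal argument makes the inner products with the countably many terms \<open>u m\<close> converge. The set
  \<open>V\<close> of all \<open>y\<close> along which the subsequence converges is a closed subspace that contains every term
  of the subsequence. A vector orthogonal to \<open>V\<close> is thus orthogonal to all those terms, and so lies
  in \<open>V\<close> trivially; hence \<open>V\<close> is the whole space, even if that is not separable. The limits
  define a bounded functional, and its Riesz representative is the weak limit.
\<close>

lemma bounded_imp_weakly_convergent_subsequence:
  fixes u :: "nat \<Rightarrow> 'a::{real_inner, complete_space}"
  assumes B: "\<And>n. norm (u n) \<le> B"
  shows "\<exists>k l. strict_mono (k :: nat \<Rightarrow> nat) \<and> weakly_converges (u \<circ> k) l"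
proof -
  have "norm (inner (u n) (u m)) \<le> B * B" for n m
  proof -
    have "norm (inner (u n) (u m)) \<le> norm (u n) * norm (u m)"
      using Cauchy_Schwarz_ineq2 by simp
    also have "\<dots> \<le> B * B"
      using B by (intro mult_mono) (auto intro: order_trans[OF norm_ge_zero])
    finally show ?thesis .
  qed
  then obtain k :: "nat \<Rightarrow> nat" where k: "strict_mono k"
      "\<And>m. \<exists>c. (\<lambda>n. inner (u (k n)) (u m)) \<longlonglongrightarrow> c"
    using function_convergent_subsequence[of "UNIV :: nat set" "\<lambda>n m. inner (u n) (u m)"]
    by (metis UNIV_I countableI_type)
  define w where "w = u \<circ> k"
  have wB: "norm (w n) \<le> B" for n by (simp add: w_def B)
  define V where "V = {y. convergent (\<lambda>n. inner (w n) y)}"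
  have V: "subspace V" "closed V"
    by (auto simp: V_def subspace_def inner_add_right convergent_const
          intro: convergent_add convergent_mult closed_Collect_convergent_inner wB)
  have wV: "w n \<in> V" for n
    using k(2)[of "k n"] by (auto simp: V_def w_def convergent_def)
  have V_UNIV: "y \<in> V" for y
  proof -
    let ?p = "metric_proj V y"
    have "?p \<in> V"
      using V subspace_0 subspace_imp_convex by (intro metric_proj_in) auto
    moreover have "inner (w n) (y - ?p) = 0" for n
      using metric_proj_subspace_orthogonal[OF V wV] by (simp add: inner_commute)
    then have "y - ?p \<in> V" by (simp add: V_def convergent_const)
    ultimately have "?p + (y - ?p) \<in> V" by (intro subspace_add V)
    then show ?thesis by simp
  qed
  define g where "g y = lim (\<lambda>n. inner (w n) y)" for y
  have g: "(\<lambda>n. inner (w n) y) \<longlonglongrightarrow> g y" for y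
    using V_UNIV[of y] by (simp add: V_def g_def convergent_LIMSEQ_iff)
  have "bounded_linear g"
  proof (rule bounded_linear_intro[where K = B])
    fix y z :: 'a and r :: real
    show "g (y + z) = g y + g z"
      using g[of "y + z"] tendsto_add[OF g[of y] g[of z]]
      by (intro LIMSEQ_unique) (auto simp: inner_add_right)
    show "g (r *\<^sub>R y) = r *\<^sub>R g y"
      using g[of "r *\<^sub>R y"] tendsto_mult_left[OF g[of y], of r]
      by (intro LIMSEQ_unique) auto
    have "norm (inner (w n) y) \<le> norm y * B" for n
      using Cauchy_Schwarz_ineq2[of "w n" y] mult_right_mono[OF wB[of n] norm_ge_zero[of y]]
      by (simp add: mult.commute)
    then show "norm (g y) \<le> norm y * B"
      by (intro LIMSEQ_le_const2[OF tendsto_norm[OF g[of y]]]) blast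
  qed
  then obtain l where "\<And>y. g y = inner y l" using riesz_representation by blast
  then have "weakly_converges w l"
    using g by (simp add: weakly_converges_iff_inner inner_commute)
  with k(1) show ?thesis unfolding w_def by blast
qed

text \<open>
  If \<open>l\<close> were outside \<open>D\<close>, the hyperplane through its projection would separate it from
  \<open>D\<close>, and a functional that separates \<open>l\<close> from all \<open>u n\<close> contradicts weak convergence.
\<close>

lemma closed_convex_weakly_closed:
  fixes D :: "'a::{real_inner, complete_space} set"
  assumes D: "closed D" "convex D" and u: "\<And>n. u n \<in> D" and l: "weakly_converges u l"
  shows "l \<in> D"
proof -
  have D': "D \<noteq> {}" "closed D" "convex D" using D u by auto
  let ?q = "metric_proj D l"
  have "(\<lambda>n. inner (u n) (l - ?q) - inner ?q (l - ?q)) \<longlonglongrightarrow> inner l (l - ?q) - inner ?q (l - ?q)"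
    using l by (intro tendsto_diff tendsto_const) (simp add: weakly_converges_iff_inner)
  moreover have "inner (u n) (l - ?q) - inner ?q (l - ?q) \<le> 0" for n
    using metric_proj_dot[OF D' u, of l n] by (simp add: inner_diff_left[symmetric] inner_commute)
  ultimately have "inner l (l - ?q) - inner ?q (l - ?q) \<le> 0"
    by (intro LIMSEQ_le_const2) auto
  then have "inner (l - ?q) (l - ?q) \<le> 0" by (simp add: inner_diff_left)
  then have "l = ?q" by (metis inner_eq_zero_iff inner_ge_zero order_antisym right_minus_eq)
  then show ?thesis using metric_proj_in[OF D', of l] by simp
qed

section \<open>Strong convergence\<close>

text \<open>
  With \<open>p\<close> the projection of \<open>a\<close> onto \<open>F\<close>, the inequality \<open>sep\<close> says that the angle at
  \<open>x n\<close> in the triangle \<open>a\<close>, \<open>x n\<close>, \<open>p\<close> is obtuse. This gives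
  \<open>(norm (x n - p))\<^sup>2 \<le> inner (p - x n) (p - a)\<close>. The right-hand side is weakly continuous in
  \<open>x n\<close>, and the variational inequality for \<open>p\<close> makes it nonpositive once \<open>x n\<close> is replaced by
  a weak cluster point, which lies in \<open>F\<close>. Hence no subsequence can stay away from \<open>p\<close>.
\<close>

lemma weak_cluster_points_imp_strong_limit:
  fixes x :: "nat \<Rightarrow> 'a::{real_inner, complete_space}"
  assumes F: "F \<noteq> {}" "closed F" "convex F"
    and sep: "\<And>n p. p \<in> F \<Longrightarrow> inner (p - x n) (x n - a) \<ge> 0"
    and cluster: "\<And>r l. strict_mono r \<Longrightarrow> weakly_converges (x \<circ> r) l \<Longrightarrow> l \<in> F"
  shows "x \<longlonglongrightarrow> metric_proj F a"
proof (rule ccontr)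
  let ?p = "metric_proj F a"
  have "?p \<in> F" by (rule metric_proj_in[OF F])
  have bound: "(norm (x n - ?p))\<^sup>2 \<le> inner (?p - x n) (?p - a)" for n
    using sep[OF \<open>?p \<in> F\<close>, of n]
    by (simp add: power2_norm_eq_inner inner_simps inner_commute algebra_simps)
  assume "\<not> x \<longlonglongrightarrow> ?p"
  then obtain e where "e > 0" and e: "\<And>N. \<exists>n\<ge>N. e \<le> dist (x n) ?p"
    unfolding lim_sequentially by (meson not_less)
  then have "infinite {n. e \<le> dist (x n) ?p}"
    unfolding infinite_nat_iff_unbounded_le by auto
  then obtain s :: "nat \<Rightarrow> nat" where s: "strict_mono s" "\<And>n. e \<le> dist (x (s n)) ?p"
    using infinite_enumerate by blast
  \<comment> \<open>Cauchy-Schwarz turns \<open>bound\<close> into boundedness of the sequence.\<close>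
  have "norm (x n) \<le> norm ?p + norm (?p - a)" for n
  proof -
    have "(norm (x n - ?p))\<^sup>2 \<le> norm (?p - x n) * norm (?p - a)"
      using bound[of n] norm_cauchy_schwarz order_trans by blast
    then have "norm (x n - ?p) \<le> norm (?p - a)"
      by (cases "x n = ?p") (auto simp: power2_eq_square norm_minus_commute)
    then show ?thesis using norm_triangle_sub[of "x n" ?p] by simp
  qed
  then obtain k l where k: "strict_mono (k :: nat \<Rightarrow> nat)" and l: "weakly_converges ((x \<circ> s) \<circ> k) l"
    using bounded_imp_weakly_convergent_subsequence[of "x \<circ> s" "norm ?p + norm (?p - a)"] by auto
  have "l \<in> F"
    using cluster[OF strict_mono_o[OF s(1) k]] l by (simp add: o_assoc)
  have "(\<lambda>n. inner ?p (?p - a) - inner (x (s (k n))) (?p - a)) \<longlonglongrightarrow> inner ?p (?p - a) - inner l (?p - a)"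
    using l by (intro tendsto_diff tendsto_const) (simp add: weakly_converges_iff_inner)
  moreover have "e\<^sup>2 \<le> inner ?p (?p - a) - inner (x (s (k n))) (?p - a)" for n
  proof -
    have "e\<^sup>2 \<le> (norm (x (s (k n)) - ?p))\<^sup>2"
      using s(2)[of "k n"] \<open>e > 0\<close> by (intro power_mono) (auto simp: dist_norm)
    then show ?thesis using bound[of "s (k n)"] by (simp add: inner_diff_left)
  qed
  ultimately have "e\<^sup>2 \<le> inner ?p (?p - a) - inner l (?p - a)"
    by (intro LIMSEQ_le_const) auto
  also have "\<dots> \<le> 0"
    using metric_proj_dot[OF F \<open>l \<in> F\<close>, of a]
    by (simp add: inner_simps inner_commute algebra_simps)
  finally show False using \<open>e > 0\<close> by simp
qed

text \<open>
  The angle at \<open>x n\<close> between \<open>a\<close> and \<open>x (Suc n)\<close> is obtuse, so by Pythagoras the squared step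
  length is at most the increment of the squared distance to \<open>a\<close>. These increments telescope and
  the distances are bounded.
\<close>

lemma successive_differences_tendsto_zero:
  fixes x :: "nat \<Rightarrow> 'a::real_inner"
  assumes step: "\<And>n. inner (x (Suc n) - x n) (x n - a) \<ge> 0"
    and B: "\<And>n. norm (x n - a) \<le> B"
  shows "(\<lambda>n. norm (x n - x (Suc n))) \<longlonglongrightarrow> 0"
proof -
  define d where "d n = (norm (x n - a))\<^sup>2" for n
  have gap: "(norm (x n - x (Suc n)))\<^sup>2 \<le> d (Suc n) - d n" for n
    using step[of n] by (simp add: d_def power2_norm_eq_inner inner_simps inner_commute algebra_simps)
  have "incseq d"
  proof (rule incseq_SucI)
    show "d n \<le> d (Suc n)" for n using gap[of n] zero_le_power2[of "norm (x n - x (Suc n))"] by linarith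
  qed
  moreover have "d n \<le> B\<^sup>2" for n unfolding d_def by (intro power_mono B) simp
  ultimately obtain c where c: "d \<longlonglongrightarrow> c" by (meson incseq_convergent)
  have "(\<lambda>n. d (Suc n) - d n) \<longlonglongrightarrow> 0"
    using tendsto_diff[OF LIMSEQ_Suc[OF c] c] by simp
  then have "(\<lambda>n. (norm (x n - x (Suc n)))\<^sup>2) \<longlonglongrightarrow> 0"
    by (rule tendsto_sandwich[OF _ _ tendsto_const, rotated 2]) (auto simp: gap)
  from tendsto_real_sqrt[OF this] show ?thesis by simp
qed

theorem theorem3p1:
  fixes C :: "'a::{real_inner, complete_space} set"
    and T :: "'a \<Rightarrow> 'a"
    and L M :: real
    and \<mu> :: "nat \<Rightarrow> real"
    and \<theta> :: "nat \<Rightarrow> 'a \<Rightarrow> real"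
    and x :: "nat \<Rightarrow> 'a"
    and Cn Cstar Q :: "nat \<Rightarrow> 'a set"
  assumes C: "C \<noteq> {}" "closed C" "convex C"
    and T_maps: "\<forall>y\<in>C. T y \<in> C"
    and T_lipschitz: "\<forall>y\<in>C. \<forall>z\<in>C. norm (T y - T z) \<le> L * norm (y - z)"
    and F: "fixed_points C T \<noteq> {}" "closed (fixed_points C T)" "convex (fixed_points C T)"
    and demiclosed: "demiclosed_at_zero C (\<lambda>y. y - T y)"
    and \<mu>_bounds: "\<forall>n. L + 1 \<le> \<mu> n \<and> \<mu> n \<le> M"
    and \<theta>_nonneg: "\<forall>n. \<forall>z\<in>C. 0 \<le> \<theta> n z"
    and x0: "x 0 \<in> C"
    and Cn: "\<forall>n. Cn n = {z \<in> C. norm (x n - T (x n)) \<le> \<mu> n * norm (x n - z) + \<theta> n z}"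
    and Q: "\<forall>n. Q n = {z \<in> C. inner (z - x n) (x n - x 0) \<ge> 0}"
    and Cstar: "\<forall>n. closed (Cstar n) \<and> convex (Cstar n) \<and>
                  fixed_points C T \<subseteq> Cstar n \<and> Cstar n \<subseteq> Cn n"
    and x_step: "\<forall>n. x (Suc n) = metric_proj (Cstar n \<inter> Q n) (x 0)"
    and \<theta>_lim: "(\<lambda>n. \<theta> n (x (Suc n))) \<longlonglongrightarrow> 0"
  shows "x \<longlonglongrightarrow> metric_proj (fixed_points C T) (x 0)"
proof -
  let ?F = "fixed_points C T"
  have Qn: "closed (Q n)" "convex (Q n)" "Q n \<subseteq> C" for n
  proof -
    have eq: "Q n = C \<inter> {z. inner (x n - x 0) z \<ge> inner (x n - x 0) (x n)}"
      using Q by (auto simp: inner_diff_left inner_diff_right inner_commute)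
    show "closed (Q n)" "convex (Q n)" "Q n \<subseteq> C"
      unfolding eq using C by (auto intro!: closed_Int convex_Int closed_halfspace_ge convex_halfspace_ge)
  qed
  \<comment> \<open>This keeps the sets that are projected onto nonempty. The induction is needed because
    \<open>x (Suc n)\<close> satisfies the variational inequality only if the projection defining it exists.\<close>
  have FQ: "?F \<subseteq> Q n" for n
  proof (induction n)
    case 0
    then show ?case using Q by (auto simp: fixed_points_def)
  next
    case (Suc n)
    \<comment> \<open>The variational inequality for the projection \<open>x (Suc n)\<close> is exactly the inequality
      that defines \<open>Q (Suc n)\<close>.\<close>
    let ?D = "Cstar n \<inter> Q n"
    have FD: "?F \<subseteq> ?D" using Suc Cstar by blast
    have D: "?D \<noteq> {}" "closed ?D" "convex ?D"
      using F(1) FD Qn Cstar by (blast intro: closed_Int convex_Int)+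
    have "inner (z - x (Suc n)) (x (Suc n) - x 0) \<ge> 0" if "z \<in> ?F" for z
      using metric_proj_dot[OF D, of z "x 0"] that FD x_step
      by (auto simp: inner_simps inner_commute algebra_simps)
    then show ?case using Q by (auto simp: fixed_points_def)
  qed
  have x_Suc: "x (Suc n) \<in> Cstar n \<inter> Q n" for n
  proof -
    have "Cstar n \<inter> Q n \<noteq> {}" "closed (Cstar n \<inter> Q n)" "convex (Cstar n \<inter> Q n)"
      using F(1) FQ[of n] Qn[of n] Cstar by (blast intro: closed_Int convex_Int)+
    then show ?thesis
      using metric_proj_in[of "Cstar n \<inter> Q n" "x 0"] x_step by simp
  qed
  have xC: "x n \<in> C" for n
  proof (cases n)
    case 0
    then show ?thesis using x0 by simp
  next
    case (Suc m)
    then show ?thesis using x_Suc[of m] Qn(3)[of m] by auto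
  qed
  have sep: "inner (p - x n) (x n - x 0) \<ge> 0" if "p \<in> ?F" for n p
    using that FQ[of n] Q by auto
  obtain p where p: "p \<in> ?F" using F(1) by blast
  have bound: "norm (x n - x 0) \<le> norm (p - x 0)" for n
  proof -
    have "(norm (x n - x 0))\<^sup>2 \<le> inner (p - x 0) (x n - x 0)"
      using sep[OF p, of n] by (simp add: power2_norm_eq_inner inner_simps)
    also have "\<dots> \<le> norm (p - x 0) * norm (x n - x 0)" by (rule norm_cauchy_schwarz)
    finally show ?thesis by (cases "x n = x 0") (auto simp: power2_eq_square)
  qed
  have "inner (x (Suc n) - x n) (x n - x 0) \<ge> 0" for n
    using x_Suc[of n] Q by auto
  then have steps: "(\<lambda>n. norm (x n - x (Suc n))) \<longlonglongrightarrow> 0"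
    using bound by (rule successive_differences_tendsto_zero)
  have residual: "(\<lambda>n. x n - T (x n)) \<longlonglongrightarrow> 0"
  proof (rule Lim_null_comparison)
    show "\<forall>\<^sub>F n in sequentially.
        norm (x n - T (x n)) \<le> M * norm (x n - x (Suc n)) + \<theta> n (x (Suc n))"
    proof (intro always_eventually allI)
      fix n
      have "x (Suc n) \<in> Cn n" using x_Suc[of n] Cstar by blast
      then have "norm (x n - T (x n)) \<le> \<mu> n * norm (x n - x (Suc n)) + \<theta> n (x (Suc n))"
        using Cn by blast
      also have "\<dots> \<le> M * norm (x n - x (Suc n)) + \<theta> n (x (Suc n))"
        using \<mu>_bounds by (intro add_right_mono mult_right_mono) auto
      finally show "norm (x n - T (x n)) \<le> M * norm (x n - x (Suc n)) + \<theta> n (x (Suc n))" .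
    qed
    show "(\<lambda>n. M * norm (x n - x (Suc n)) + \<theta> n (x (Suc n))) \<longlonglongrightarrow> 0"
      using tendsto_add[OF tendsto_mult_right_zero[OF steps, of M] \<theta>_lim] by simp
  qed
  show ?thesis
  proof (rule weak_cluster_points_imp_strong_limit[OF F])
    show "inner (p - x n) (x n - x 0) \<ge> 0" if "p \<in> ?F" for n p by (rule sep[OF that])
    fix r :: "nat \<Rightarrow> nat" and l
    assume r: "strict_mono r" and l: "weakly_converges (x \<circ> r) l"
    have "l \<in> C" using closed_convex_weakly_closed[OF C(2,3) _ l] xC by simp
    moreover have "(\<lambda>n. (x \<circ> r) n - T ((x \<circ> r) n)) \<longlonglongrightarrow> 0"
      using LIMSEQ_subseq_LIMSEQ[OF residual r] by (simp add: o_def)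
    moreover have "\<forall>n. (x \<circ> r) n \<in> C" using xC by simp
    ultimately have "l - T l = 0"
      using demiclosed l unfolding demiclosed_at_zero_def by blast
    with \<open>l \<in> C\<close> show "l \<in> ?F" by (simp add: fixed_points_def)
  qed
qed

end
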